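(* Let $m_1=p_1^{e_1}\cdots p_r^{e_r}$ be a product of powers of $r>1$ distinct odd primes and $m_2=q_1^{c_1}\cdots q_\ell^{c_\ell}$ a product of powers of $\ell>1$ distinct odd primes, with $\gcd(m_1,m_2)=1$, and $m=m_1m_2$. Let $t_1,t_2,t$ be the multiplicative orders of $2$ modulo $m_1,m_2,m$, so that $\mathbf{F}_{2^{t_1}},\mathbf{F}_{2^{t_2}}$ are subfields of $\mathbf{F}_{2^t}$. Let $\gamma\in\mathbf{F}_{2^t}$ have order $m$, $\gamma_1\in\mathbf{F}_{2^{t_1}}$ order $m_1$, $\gamma_2\in\mathbf{F}_{2^{t_2}}$ order $m_2$. Suppose $P_1\in\mathbf{F}_{2^{t_1}}[x]$ is an $S_{m_1}$-decoding polynomial w.r.t. $\gamma_1$ with $k_1$ monomials and $P_2\in\mathbf{F}_{2^{t_2}}[x]$ is an $S_{m_2}$-decoding polynomial w.r.t. $\gamma_2$ with $k_2$ monomials. Then there is an $S_m$-decoding polynomial $P\in\mathbf{F}_{2^t}[x]$ w.r.t. $\gamma$ with $k\le k_1k_2$ monomials such that for all $n,h\ge1$ and every family of $S_m$-matching vectors $\vec u_1,\dots,\vec u_n\in\mathbf{Z}_m^h$, the code $C:\mathbf{F}_{2^t}^n\to\mathbf{F}_{2^t}^{m^h}$ built from $\gamma,P,\vec u_1,\dots,\vec u_n$ is a $k$-query locally decodable code whose decoder $\{D_i\}$ is perfectly smooth.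
   Context: For $m=\prod_i p_i^{e_i}$ (distinct primes), $S_m=\{s\in\mathbf{Z}_m\setminus\{0\}: \text{for each } i,\ s\equiv0\text{ or }1 \pmod{p_i^{e_i}}\}$. $\langle\vec x,\vec y\rangle_m=\sum_jx_jy_j\bmod m$. Vectors $\vec u_1,\dots,\vec u_n\in\mathbf{Z}_m^h$ are $S$-matching if $\langle\vec u_i,\vec u_i\rangle_m=0$ and $\langle\vec u_i,\vec u_j\rangle_m\in S$ for $i\neq j$. For $\gamma$ of order $m$, $P$ is an $S$-decoding polynomial if $P(\gamma^s)=0$ for $s\in S$ and $P(1)=1$. Construction: $P(x)=\sum_{j=0}^{k-1}a_jx^{b_j}$ (distinct $b_j$); coordinates indexed by $\vec z\in\mathbf{Z}_m^h$; $C(\vec x)=\sum_ix_iC(\vec e_i)$, $C(\vec e_i)=(\gamma^{\langle\vec u_i,\vec z\rangle_m})_{\vec z}$; $D_i$ on $\vec y$ picks uniform $\vec v\in\mathbf{Z}_m^h$, queries $\vec y(\vec v+b_j\vec u_i)$, $j=0,\dots,k-1$, and outputs $\gamma^{-\langle\vec u_i,\vec v\rangle_m}\sum_ja_j\vec y(\vec v+b_j\vec u_i)$. A decoder is perfectly smooth if $\Pr[D_i(C(\vec x))=x_i]=1$ for all $\vec x,i$ and each query is uniformly distributed over the $N$ coordinates. *)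

theory Defs
  imports
    "HOL-Algebra.Algebraic_Closure_Type"
    "HOL-Number_Theory.Number_Theory"
    "HOL-Probability.Probability"
    "HOL-Computational_Algebra.Computational_Algebra"
begin

section \<open>Vectors over the integers modulo m, and matching families\<close>

text \<open>
  The elements of \<open>Z\<^sub>m\<close> are represented by their residues \<open>0, \<dots>, m - 1\<close>, and vectors of length
  \<open>h\<close> by extensional functions on \<open>{..<h}\<close>, so that \<open>zvecs m h\<close> has exactly \<open>m ^ h\<close> elements.
\<close>

definition zvecs :: "nat \<Rightarrow> nat \<Rightarrow> (nat \<Rightarrow> nat) set" where
  "zvecs m h = ({..<h} \<rightarrow>\<^sub>E {..<m})"

definition zinner :: "nat \<Rightarrow> nat \<Rightarrow> (nat \<Rightarrow> nat) \<Rightarrow> (nat \<Rightarrow> nat) \<Rightarrow> nat" where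
  "zinner m h x y = (\<Sum>j<h. x j * y j) mod m"

definition zshift ::
    "nat \<Rightarrow> nat \<Rightarrow> (nat \<Rightarrow> nat) \<Rightarrow> nat \<Rightarrow> (nat \<Rightarrow> nat) \<Rightarrow> nat \<Rightarrow> nat" where
  \<comment> \<open>the vector \<open>v + b u\<close>\<close>
  "zshift m h v b u = (\<lambda>j\<in>{..<h}. (v j + b * u j) mod m)"

definition canonical_set :: "nat \<Rightarrow> nat set" where
  "canonical_set m =
     {s. 0 < s \<and> s < m \<and>
         (\<forall>p\<in>prime_factors m.
            [s = 0] (mod p ^ multiplicity p m) \<or> [s = 1] (mod p ^ multiplicity p m))}"

definition matching_vectors ::
    "nat \<Rightarrow> nat \<Rightarrow> nat set \<Rightarrow> nat \<Rightarrow> (nat \<Rightarrow> nat \<Rightarrow> nat) \<Rightarrow> bool" where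
  "matching_vectors m h S n u \<longleftrightarrow>
     (\<forall>i<n. u i \<in> zvecs m h) \<and>
     (\<forall>i<n. zinner m h (u i) (u i) = 0) \<and>
     (\<forall>i<n. \<forall>j<n. i \<noteq> j \<longrightarrow> zinner m h (u i) (u j) \<in> S)"

section \<open>Decoding polynomials\<close>

definition has_mult_order :: "'a::monoid_mult \<Rightarrow> nat \<Rightarrow> bool" where
  "has_mult_order g m \<longleftrightarrow> 0 < m \<and> g ^ m = 1 \<and> (\<forall>d. 0 < d \<and> d < m \<longrightarrow> g ^ d \<noteq> 1)"

definition decoding_poly :: "nat set \<Rightarrow> 'a::comm_ring_1 \<Rightarrow> 'a poly \<Rightarrow> bool" where
  "decoding_poly S g P \<longleftrightarrow> (\<forall>s\<in>S. poly P (g ^ s) = 0) \<and> poly P 1 = 1"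

definition exponents :: "'a::zero poly \<Rightarrow> nat list" where
  \<comment> \<open>the exponents \<open>b\<^sub>0 < b\<^sub>1 < \<dots>\<close> of the monomials that occur with nonzero coefficient\<close>
  "exponents P = sorted_list_of_set {b. Polynomial.coeff P b \<noteq> 0}"

definition num_monomials :: "'a::zero poly \<Rightarrow> nat" where
  "num_monomials P = card {b. Polynomial.coeff P b \<noteq> 0}"

section \<open>Codes with query decoders\<close>

text \<open>
  A randomized non-adaptive decoder draws a random seed, queries the word at a list of coordinates
  that depends only on the seed, and computes its output from the seed and the answers alone.
\<close>

record ('r, 'c, 'a) query_decoder =
  seed :: "'r pmf"
  queries :: "'r \<Rightarrow> 'c list"
  answer :: "'r \<Rightarrow> 'a list \<Rightarrow> 'a"

definition run_decoder :: "('r, 'c, 'a) query_decoder \<Rightarrow> ('c \<Rightarrow> 'a) \<Rightarrow> 'a pmf" where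
  "run_decoder D y = map_pmf (\<lambda>r. answer D r (map y (queries D r))) (seed D)"

text \<open>
  Codes map \<open>words {..<n}\<close> to \<open>words I\<close>, where \<open>I\<close> is the finite set of coordinates of codewords.
\<close>

definition words :: "'c set \<Rightarrow> ('c \<Rightarrow> 'a) set" where
  "words I = (I \<rightarrow>\<^sub>E UNIV)"

definition locally_decodable ::
    "nat \<Rightarrow> real \<Rightarrow> real \<Rightarrow> nat \<Rightarrow> 'c set \<Rightarrow> ((nat \<Rightarrow> 'a) \<Rightarrow> 'c \<Rightarrow> 'a) \<Rightarrow>
     (nat \<Rightarrow> ('r, 'c, 'a) query_decoder) \<Rightarrow> bool" where
  \<comment> \<open>\<open>(k, \<delta>, \<epsilon>)\<close>-local decodability, witnessed by the decoders \<open>D i\<close>\<close>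
  "locally_decodable k \<delta> \<epsilon> n I C D \<longleftrightarrow>
     C \<in> words {..<n} \<rightarrow> words I \<and>
     (\<forall>i<n. \<forall>r\<in>set_pmf (seed (D i)).
        length (queries (D i) r) \<le> k \<and> set (queries (D i) r) \<subseteq> I) \<and>
     (\<forall>i<n. \<forall>x\<in>words {..<n}. \<forall>y\<in>words I.
        real (card {z\<in>I. y z \<noteq> C x z}) \<le> \<delta> * real (card I) \<longrightarrow>
        measure_pmf.prob (run_decoder (D i) y) {x i} \<ge> 1 - \<epsilon>)"

definition perfectly_smooth ::
    "nat \<Rightarrow> nat \<Rightarrow> 'c set \<Rightarrow> ((nat \<Rightarrow> 'a) \<Rightarrow> 'c \<Rightarrow> 'a) \<Rightarrow>
     (nat \<Rightarrow> ('r, 'c, 'a) query_decoder) \<Rightarrow> bool" where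
  "perfectly_smooth k n I C D \<longleftrightarrow>
     (\<forall>i<n. \<forall>r\<in>set_pmf (seed (D i)). length (queries (D i) r) = k) \<and>
     (\<forall>i<n. \<forall>x\<in>words {..<n}. measure_pmf.prob (run_decoder (D i) (C x)) {x i} = 1) \<and>
     (\<forall>i<n. \<forall>j<k. map_pmf (\<lambda>r. queries (D i) r ! j) (seed (D i)) = pmf_of_set I)"

section \<open>The matching vector code\<close>

definition mv_unit :: "nat \<Rightarrow> nat \<Rightarrow> 'a::field \<Rightarrow> (nat \<Rightarrow> nat \<Rightarrow> nat) \<Rightarrow> nat \<Rightarrow> (nat \<Rightarrow> nat) \<Rightarrow> 'a" where
  \<comment> \<open>the encoding of the \<open>i\<close>-th unit vector\<close>
  "mv_unit m h g u i = (\<lambda>z\<in>zvecs m h. g ^ zinner m h (u i) z)"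

definition mv_code ::
    "nat \<Rightarrow> nat \<Rightarrow> 'a::field \<Rightarrow> nat \<Rightarrow> (nat \<Rightarrow> nat \<Rightarrow> nat) \<Rightarrow>
     (nat \<Rightarrow> 'a) \<Rightarrow> (nat \<Rightarrow> nat) \<Rightarrow> 'a" where
  "mv_code m h g n u x = (\<lambda>z\<in>zvecs m h. \<Sum>i<n. x i * mv_unit m h g u i z)"

definition mv_decoder ::
    "nat \<Rightarrow> nat \<Rightarrow> 'a::field \<Rightarrow> 'a poly \<Rightarrow> (nat \<Rightarrow> nat \<Rightarrow> nat) \<Rightarrow> nat \<Rightarrow>
     (nat \<Rightarrow> nat, nat \<Rightarrow> nat, 'a) query_decoder" where
  "mv_decoder m h g P u i =
     \<lparr> seed = pmf_of_set (zvecs m h),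
       queries = (\<lambda>v. map (\<lambda>b. zshift m h v b (u i)) (exponents P)),
       answer = (\<lambda>v ys. inverse (g ^ zinner m h (u i) v) *
                   (\<Sum>j<num_monomials P. Polynomial.coeff P (exponents P ! j) * ys ! j)) \<rparr>"

end

theory Submission
  imports Defs
begin

text \<open>
  The polynomial is \<open>P(x) = P1(x\<^bsup>a\<^esup>) P2(x\<^bsup>b\<^esup>)\<close>, where \<open>\<gamma>1 = \<gamma>\<^bsup>a\<^esup>\<close> and \<open>\<gamma>2 = \<gamma>\<^bsup>b\<^esup>\<close>: such exponents
  exist because the powers of \<open>\<gamma>\<close> already exhaust the at most \<open>m\<close> roots of \<open>x\<^bsup>m\<^esup> - 1\<close>. If \<open>s\<close> lies in
  the canonical set of \<open>m1 m2\<close>, then one of the residues \<open>s mod m1\<close>, \<open>s mod m2\<close> is nonzero, hence lies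
  in the canonical set of that factor, and the corresponding factor of \<open>P(\<gamma>\<^bsup>s\<^esup>)\<close> vanishes.
  Smoothness of the decoder holds because \<open>v \<mapsto> v + b u\<close> permutes the coordinates, and it implies
  local decodability by a union bound over the queries.
\<close>

section \<open>Roots of unity and canonical sets\<close>

lemma pow_mod_order:
  fixes g :: "'a::monoid_mult"
  assumes "g ^ m = 1"
  shows "g ^ (n mod m) = g ^ n"
proof -
  have "g ^ n = g ^ (m * (n div m) + n mod m)"
    by simp
  also have "\<dots> = g ^ (n mod m)"
    by (simp only: power_add power_mult assms power_one mult_1_left)
  finally show ?thesis by simp
qed

text \<open>If two of these powers agreed, cancelling the smaller one would give
  \<open>g ^ (j - i) = 1\<close> with an exponent strictly between 0 and \<open>m\<close>.\<close>

lemma has_mult_order_inj_on: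
  fixes g :: "'a::field"
  assumes "has_mult_order g m"
  shows "inj_on (\<lambda>i. g ^ i) {..<m}"
proof (rule linorder_inj_onI)
  fix i j assume ij: "i < j" "i \<in> {..<m}" "j \<in> {..<m}"
  have g0: "g \<noteq> 0"
    using assms by (auto simp: has_mult_order_def power_0_left split: if_splits)
  have "g ^ j = g ^ i * g ^ (j - i)"
    using ij by (simp flip: power_add)
  moreover have "g ^ (j - i) \<noteq> 1"
    using assms ij by (auto simp: has_mult_order_def)
  ultimately show "g ^ i \<noteq> g ^ j"
    using g0 by auto
qed auto

lemma root_of_unity_is_power:
  fixes g w :: "'a::field"
  assumes g: "has_mult_order g m" and w: "w ^ m = 1"
  shows "\<exists>a. w = g ^ a"
proof -
  have m: "0 < m" "g ^ m = 1"
    using g by (auto simp: has_mult_order_def)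
  define R where "R = {x::'a. x ^ m = 1}"
  define f :: "'a poly" where "f = Polynomial.monom 1 m - 1"
  \<comment> \<open>The exact degree caps the number of roots at \<open>m\<close>, which the
    \<open>m\<close> distinct powers of \<open>g\<close> attain.\<close>
  have "Polynomial.degree (Polynomial.monom (1::'a) m + (- 1)) = m"
    using m by (subst Polynomial.degree_add_eq_left) (simp_all add: Polynomial.degree_monom_eq)
  then have deg: "Polynomial.degree f = m"
    by (simp add: f_def)
  then have f: "f \<noteq> 0" using m by auto
  have R: "R = {x. poly f x = 0}"
    by (simp add: R_def f_def poly_monom)
  have fin: "finite R" and "card R \<le> m"
    using f poly_roots_finite[OF f] card_poly_roots_bound[OF f] deg by (simp_all add: R)
  moreover have "(\<lambda>i. g ^ i) ` {..<m} \<subseteq> R"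
  proof (clarsimp simp: R_def)
    fix i show "(g ^ i) ^ m = 1"
      by (metis m(2) mult.commute power_mult power_one)
  qed
  moreover have "card ((\<lambda>i. g ^ i) ` {..<m}) = m"
    using has_mult_order_inj_on[OF g] by (simp add: card_image)
  ultimately have "(\<lambda>i. g ^ i) ` {..<m} = R"
    by (metis card_mono card_subset_eq le_antisym)
  with w show ?thesis by (auto simp: R_def)
qed

text \<open>The \<open>p\<close>-part of \<open>d\<close> divides the \<open>p\<close>-part of
  \<open>m\<close>, so being 0 or 1 modulo prime powers is inherited by \<open>d\<close>. Only the
  residue being nonzero can fail, and \<open>nz\<close> rules that out.\<close>

lemma canonical_set_mod_dvd:
  assumes s: "s \<in> canonical_set m" and d: "d dvd m" and nz: "\<not> d dvd s"
  shows "s mod d \<in> canonical_set d"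
proof -
  have m: "m > 0" using s by (auto simp: canonical_set_def)
  with d have d0: "d > 0" by (auto intro: Nat.gr0I)
  show ?thesis
    unfolding canonical_set_def
  proof (intro CollectI conjI ballI)
    show "0 < s mod d" using nz by (simp add: mod_greater_zero_iff_not_dvd)
    show "s mod d < d" using d0 by simp
    fix p assume p: "p \<in> prime_factors d"
    let ?q = "p ^ multiplicity p d"
    have "?q dvd p ^ multiplicity p m"
      using m d by (intro le_imp_power_dvd dvd_imp_multiplicity_le) auto
    moreover have "p \<in> prime_factors m"
      using p d m by (auto simp: in_prime_factors_iff intro: dvd_trans)
    ultimately have "[s = 0] (mod ?q) \<or> [s = 1] (mod ?q)"
      using s by (auto simp: canonical_set_def intro: cong_dvd_modulus_nat)
    moreover have "[s mod d = s] (mod ?q)"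
      by (rule cong_dvd_modulus_nat[of _ _ d]) (auto simp: multiplicity_dvd)
    ultimately show "[s mod d = 0] (mod ?q) \<or> [s mod d = 1] (mod ?q)"
      by (metis cong_trans)
  qed
qed

section \<open>Products of decoding polynomials\<close>

lemma finite_coeff_support: "finite {b. Polynomial.coeff P b \<noteq> 0}"
  by (rule finite_subset[of _ "{..Polynomial.degree P}"]) (auto intro: le_degree)

lemma poly_eq_sum_support:
  fixes P :: "'a::comm_semiring_1 poly"
  shows "poly P x = (\<Sum>b | Polynomial.coeff P b \<noteq> 0. Polynomial.coeff P b * x ^ b)"
  unfolding Polynomial.poly_altdef
  by (rule sum.mono_neutral_right) (auto intro: le_degree)

lemma decoding_poly_mult_powers:
  fixes g1 g2 :: "'a::field"
  assumes m: "coprime m1 m2"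
    and o1: "g1 ^ m1 = 1" and o2: "g2 ^ m2 = 1"
    and g: "g ^ a1 = g1" "g ^ a2 = g2"
    and P1: "decoding_poly (canonical_set m1) g1 P1"
    and P2: "decoding_poly (canonical_set m2) g2 P2"
  shows "\<exists>P. decoding_poly (canonical_set (m1 * m2)) g P \<and>
             num_monomials P \<le> num_monomials P1 * num_monomials P2"
proof -
  let ?A = "{b. Polynomial.coeff P1 b \<noteq> 0}" and ?B = "{b. Polynomial.coeff P2 b \<noteq> 0}"
  \<comment> \<open>The product is expanded into monomials from the start, so that its support can
    be read off from pairs of exponents.\<close>
  define P where "P = (\<Sum>(i, j) \<in> ?A \<times> ?B.
    Polynomial.monom (Polynomial.coeff P1 i * Polynomial.coeff P2 j) (a1 * i + a2 * j))"
  have P: "poly P x = poly P1 (x ^ a1) * poly P2 (x ^ a2)" for x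
    by (simp add: P_def poly_sum poly_monom poly_eq_sum_support[of P1] poly_eq_sum_support[of P2]
        sum_product sum.cartesian_product case_prod_unfold power_add power_mult mult_ac)
  \<comment> \<open>Different pairs may share an exponent, and their terms may merge or cancel;
    hence an inclusion, and only an upper bound on the number of monomials.\<close>
  have "{b. Polynomial.coeff P b \<noteq> 0} \<subseteq> (\<lambda>(i, j). a1 * i + a2 * j) ` (?A \<times> ?B)"
  proof
    fix b assume "b \<in> {b. Polynomial.coeff P b \<noteq> 0}"
    then have "(\<Sum>ij\<in>?A \<times> ?B. Polynomial.coeff (case ij of (i, j) \<Rightarrow>
        Polynomial.monom (Polynomial.coeff P1 i * Polynomial.coeff P2 j) (a1 * i + a2 * j)) b) \<noteq> 0"
      by (simp add: P_def coeff_sum)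
    then obtain ij where "ij \<in> ?A \<times> ?B" "Polynomial.coeff (case ij of (i, j) \<Rightarrow>
        Polynomial.monom (Polynomial.coeff P1 i * Polynomial.coeff P2 j) (a1 * i + a2 * j)) b \<noteq> 0"
      by (rule sum.not_neutral_contains_not_neutral)
    then show "b \<in> (\<lambda>(i, j). a1 * i + a2 * j) ` (?A \<times> ?B)"
      by (force split: if_splits)
  qed
  then have "num_monomials P \<le> card (?A \<times> ?B)"
    unfolding num_monomials_def by (intro surj_card_le) (auto simp: finite_coeff_support)
  also have "\<dots> = num_monomials P1 * num_monomials P2"
    by (simp add: num_monomials_def card_cartesian_product)
  finally have "num_monomials P \<le> num_monomials P1 * num_monomials P2" .
  moreover have "decoding_poly (canonical_set (m1 * m2)) g P"
    unfolding decoding_poly_def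
  proof (intro conjI ballI)
    show "poly P 1 = 1" using P1 P2 by (simp add: P decoding_poly_def)
    fix s assume s: "s \<in> canonical_set (m1 * m2)"
    \<comment> \<open>Since \<open>0 < s < m1 * m2\<close>, coprimality forbids that both factors
      divide \<open>s\<close>.\<close>
    have "\<not> m1 * m2 dvd s" using s by (auto simp: canonical_set_def dest: dvd_imp_le)
    then have "\<not> m1 dvd s \<or> \<not> m2 dvd s" using m by (auto intro: divides_mult)
    then have "poly P1 (g1 ^ (s mod m1)) = 0 \<or> poly P2 (g2 ^ (s mod m2)) = 0"
      using canonical_set_mod_dvd[OF s, of m1] canonical_set_mod_dvd[OF s, of m2] P1 P2
      by (auto simp: decoding_poly_def)
    moreover have "(g ^ s) ^ a1 = g1 ^ (s mod m1)" "(g ^ s) ^ a2 = g2 ^ (s mod m2)"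
      using g by (auto simp: pow_mod_order o1 o2 mult.commute simp flip: power_mult)
    ultimately show "poly P (g ^ s) = 0" by (auto simp: P)
  qed
  ultimately show ?thesis by blast
qed

section \<open>Smooth decoders\<close>

text \<open>A uniform query hits a corrupted coordinate with probability at most \<delta>. Unless
  one of the \<open>k\<close> queries does, the answers are those of the uncorrupted codeword, on
  which the decoder is always right.\<close>

lemma perfectly_smooth_imp_locally_decodable:
  fixes C :: "(nat \<Rightarrow> 'a) \<Rightarrow> 'c \<Rightarrow> 'a" and D :: "nat \<Rightarrow> ('r, 'c, 'a) query_decoder"
  assumes smooth: "perfectly_smooth k n I C D"
    and I: "finite I" "I \<noteq> {}"
    and C: "C \<in> words {..<n} \<rightarrow> words I"
  shows "locally_decodable k \<delta> (real k * \<delta>) n I C D"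
  unfolding locally_decodable_def
proof (intro conjI allI impI ballI)
  show "C \<in> words {..<n} \<rightarrow> words I" by (fact C)
next
  fix i r assume i: "i < n" and r: "r \<in> set_pmf (seed (D i))"
  show len: "length (queries (D i) r) \<le> k"
    using smooth i r by (simp add: perfectly_smooth_def)
  show "set (queries (D i) r) \<subseteq> I"
  proof
    fix z assume "z \<in> set (queries (D i) r)"
    then obtain j where j: "j < k" "z = queries (D i) r ! j"
      using len by (metis in_set_conv_nth order_less_le_trans)
    then have "z \<in> set_pmf (map_pmf (\<lambda>r. queries (D i) r ! j) (seed (D i)))"
      using r by auto
    then show "z \<in> I"
      using smooth i j(1) I unfolding perfectly_smooth_def by (metis set_pmf_of_set)
  qed
next
  fix i x y
  assume i: "i < n" and x: "x \<in> words {..<n}" and y: "y \<in> words I"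
    and err: "real (card {z\<in>I. y z \<noteq> C x z}) \<le> \<delta> * real (card I)"
  let ?M = "seed (D i)"
  let ?q = "queries (D i)"
  let ?Z = "{z\<in>I. y z \<noteq> C x z}"
  let ?bad = "\<lambda>j. {r. ?q r ! j \<in> ?Z}"
  let ?good = "{r. answer (D i) r (map y (?q r)) = x i}"
  have len: "length (?q r) = k" if "r \<in> set_pmf ?M" for r
    using smooth i that by (simp add: perfectly_smooth_def)
  have unif: "map_pmf (\<lambda>r. ?q r ! j) ?M = pmf_of_set I" if "j < k" for j
    using smooth i that by (simp add: perfectly_smooth_def)
  have inI: "?q r ! j \<in> I" if "r \<in> set_pmf ?M" "j < k" for r j
    using arg_cong[OF unif[OF that(2)], of set_pmf] I that(1) by auto
  have bad: "measure_pmf.prob ?M (?bad j) \<le> \<delta>" if "j < k" for j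
  proof -
    have "measure_pmf.prob ?M (?bad j) = measure_pmf.prob (map_pmf (\<lambda>r. ?q r ! j) ?M) ?Z"
      by (simp add: vimage_def)
    also have "\<dots> = real (card ?Z) / real (card I)"
      using I by (simp add: unif[OF that] measure_pmf_of_set Int_absorb1)
    also have "\<dots> \<le> \<delta>"
      using err I by (simp add: divide_le_eq card_gt_0_iff)
    finally show ?thesis .
  qed
  \<comment> \<open>Success with probability 1 under a discrete distribution means success for every
    seed in its support.\<close>
  have correct: "answer (D i) r (map (C x) (?q r)) = x i" if r: "r \<in> set_pmf ?M" for r
  proof -
    have "measure_pmf.prob (run_decoder (D i) (C x)) {x i} = 1"
      using smooth i x by (simp add: perfectly_smooth_def)
    then have "AE z in measure_pmf (run_decoder (D i) (C x)). z \<in> {x i}"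
      by (subst (asm) measure_pmf.prob_eq_1) auto
    then show ?thesis
      using r by (auto simp: AE_measure_pmf_iff run_decoder_def)
  qed
  have "measure_pmf.prob ?M (- ?good) \<le> measure_pmf.prob ?M (\<Union>j\<in>{..<k}. ?bad j)"
  \<comment> \<open>The inclusion of events is known only for seeds in the support, where
    \<open>correct\<close>, \<open>len\<close> and \<open>inI\<close> apply.\<close>
  proof (rule measure_pmf.finite_measure_mono_AE)
    show "AE r in measure_pmf ?M. r \<in> - ?good \<longrightarrow> r \<in> (\<Union>j\<in>{..<k}. ?bad j)"
    proof (subst AE_measure_pmf_iff, intro ballI impI)
      fix r assume r: "r \<in> set_pmf ?M" and "r \<in> - ?good"
      then have "map y (?q r) \<noteq> map (C x) (?q r)"
        using correct[OF r] by (metis (mono_tags, lifting) ComplD mem_Collect_eq)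
      then obtain j where "j < k" "y (?q r ! j) \<noteq> C x (?q r ! j)"
        using len[OF r] by (auto simp: list_eq_iff_nth_eq)
      then show "r \<in> (\<Union>j\<in>{..<k}. ?bad j)"
        using inI[OF r] by auto
    qed
  qed auto
  also have "\<dots> \<le> (\<Sum>j<k. measure_pmf.prob ?M (?bad j))"
    by (intro measure_pmf.finite_measure_subadditive_finite) auto
  also have "\<dots> \<le> (\<Sum>j<k. \<delta>)"
    by (intro sum_mono bad) auto
  finally have "measure_pmf.prob ?M (- ?good) \<le> real k * \<delta>" by simp
  moreover have "measure_pmf.prob ?M (- ?good) = 1 - measure_pmf.prob ?M ?good"
    using measure_pmf.prob_compl[of ?good ?M] by (simp add: Compl_eq_Diff_UNIV)
  moreover have "measure_pmf.prob (run_decoder (D i) y) {x i} = measure_pmf.prob ?M ?good"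
    by (simp add: run_decoder_def vimage_def)
  ultimately show "1 - real k * \<delta> \<le> measure_pmf.prob (run_decoder (D i) y) {x i}"
    by linarith
qed

section \<open>Matching vector codes\<close>

lemma finite_zvecs: "finite (zvecs m h)"
  by (simp add: zvecs_def finite_PiE)

lemma zvecs_nonempty: "m > 0 \<Longrightarrow> zvecs m h \<noteq> {}"
  by (auto simp: zvecs_def PiE_eq_empty_iff)

lemma zshift_in_zvecs: "m > 0 \<Longrightarrow> zshift m h v b u \<in> zvecs m h"
  by (auto simp: zshift_def zvecs_def)

text \<open>Addition of a fixed vector cancels modulo \<open>m\<close>, and an injective self-map of
  a finite set is onto. This makes each query uniform.\<close>

lemma bij_betw_zshift:
  assumes m: "m > 0"
  shows "bij_betw (\<lambda>v. zshift m h v b u) (zvecs m h) (zvecs m h)"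
proof -
  have "inj_on (\<lambda>v. zshift m h v b u) (zvecs m h)"
  proof (rule inj_onI)
    fix v w assume vw: "v \<in> zvecs m h" "w \<in> zvecs m h" "zshift m h v b u = zshift m h w b u"
    show "v = w"
    proof (rule PiE_ext)
      show "v \<in> {..<h} \<rightarrow>\<^sub>E {..<m}" "w \<in> {..<h} \<rightarrow>\<^sub>E {..<m}"
        using vw by (auto simp: zvecs_def)
      fix j assume j: "j \<in> {..<h}"
      then have "[v j + b * u j = w j + b * u j] (mod m)"
        using fun_cong[OF vw(3), of j] by (simp add: zshift_def Cong.cong_def)
      then have "[v j = w j] (mod m)"
        by (simp add: cong_add_rcancel_nat)
      moreover have "v j < m" "w j < m"
        using vw j by (auto simp: zvecs_def)
      ultimately show "v j = w j"
        by (simp add: cong_less_modulus_unique_nat)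
    qed
  qed
  then show ?thesis
    using zshift_in_zvecs[OF m] finite_zvecs
    by (metis (mono_tags, lifting) bij_betw_def endo_inj_surj image_subsetI)
qed

text \<open>Linearity of the inner product in its second argument, carried to exponents;
  \<open>g ^ m = 1\<close> makes reductions modulo \<open>m\<close> invisible there.\<close>

lemma power_zinner_zshift:
  fixes g :: "'a::comm_monoid_mult"
  assumes g: "g ^ m = 1"
  shows "g ^ zinner m h w (zshift m h v b u) = g ^ zinner m h w v * (g ^ zinner m h w u) ^ b"
proof -
  have "(\<Sum>j<h. w j * zshift m h v b u j) mod m = (\<Sum>j<h. w j * (v j + b * u j)) mod m"
  proof -
    have "[(\<Sum>j<h. w j * zshift m h v b u j) = (\<Sum>j<h. w j * (v j + b * u j))] (mod m)"
      by (intro cong_sum cong_scalar_left) (auto simp: zshift_def Cong.cong_def)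
    then show ?thesis by (simp add: Cong.cong_def)
  qed
  also have "(\<Sum>j<h. w j * (v j + b * u j)) = (\<Sum>j<h. w j * v j) + (\<Sum>j<h. w j * u j) * b"
    by (simp add: algebra_simps sum.distrib sum_distrib_left)
  finally show ?thesis
    by (simp add: zinner_def pow_mod_order[OF g] power_add power_mult)
qed

lemma length_exponents: "length (exponents P) = num_monomials P"
  by (simp add: exponents_def num_monomials_def)

text \<open>Passes from the decoder's indexing by query position to the indexing by exponent in
  which \<open>poly P\<close> is expanded.\<close>

lemma sum_exponents:
  "(\<Sum>j<num_monomials P. f (exponents P ! j)) = (\<Sum>b | Polynomial.coeff P b \<noteq> 0. f b)"
  by (rule sum.reindex_bij_betw, rule bij_betw_nth)
     (auto simp: exponents_def num_monomials_def finite_coeff_support)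

text \<open>After swapping sums, \<open>x l\<close> is weighted by
  \<open>g ^ zinner m h (u l) v\<close> times the value of \<open>P\<close> at
  \<open>g ^ zinner m h (u l) (u i)\<close>. The matching and decoding conditions leave only
  \<open>l = i\<close>, and the decoder divides out the remaining power of \<open>g\<close>.\<close>

lemma mv_decoder_answer:
  fixes g :: "'a::field"
  assumes m: "m > 0" and g: "g ^ m = 1"
    and P: "decoding_poly S g P"
    and u: "matching_vectors m h S n u" and i: "i < n"
  shows "answer (mv_decoder m h g P u i) v
           (map (mv_code m h g n u x) (queries (mv_decoder m h g P u i) v)) = x i"
proof -
  have g0: "g \<noteq> 0" using g m by (auto simp: zero_power)
  \<comment> \<open>For \<open>l = i\<close> the inner product is 0, so \<open>P\<close> is
    evaluated at 1; otherwise it lies in \<open>S\<close>, where \<open>P\<close> vanishes.\<close>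
  have match: "poly P (g ^ zinner m h (u l) (u i)) = (if l = i then 1 else 0)" if "l < n" for l
    using u P i that by (auto simp: matching_vectors_def decoding_poly_def)
  have code: "mv_code m h g n u x (zshift m h v b (u i)) =
      (\<Sum>l<n. x l * (g ^ zinner m h (u l) v * (g ^ zinner m h (u l) (u i)) ^ b))" for b
    by (simp add: mv_code_def mv_unit_def zshift_in_zvecs[OF m] power_zinner_zshift[OF g])
  have "(\<Sum>j<num_monomials P. Polynomial.coeff P (exponents P ! j) *
           map (mv_code m h g n u x) (queries (mv_decoder m h g P u i) v) ! j) =
        (\<Sum>j<num_monomials P. Polynomial.coeff P (exponents P ! j) *
           mv_code m h g n u x (zshift m h v (exponents P ! j) (u i)))"
    by (intro sum.cong refl) (simp add: mv_decoder_def length_exponents)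
  also have "\<dots> = (\<Sum>b | Polynomial.coeff P b \<noteq> 0. Polynomial.coeff P b *
      (\<Sum>l<n. x l * (g ^ zinner m h (u l) v * (g ^ zinner m h (u l) (u i)) ^ b)))"
    unfolding code by (rule sym, rule sum_exponents[symmetric])
  also have "\<dots> = (\<Sum>l<n. x l * g ^ zinner m h (u l) v * poly P (g ^ zinner m h (u l) (u i)))"
    unfolding sum_distrib_left poly_eq_sum_support
    by (subst sum.swap) (simp add: mult_ac)
  also have "\<dots> = (\<Sum>l<n. if l = i then x i * g ^ zinner m h (u i) v else 0)"
    by (intro sum.cong refl) (auto simp: match)
  also have "\<dots> = x i * g ^ zinner m h (u i) v"
    using i by simp
  finally show ?thesis
    using g0 by (simp add: mv_decoder_def)
qed

text \<open>Correctness holds seed by seed, hence with probability 1; each query is the image of a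
  uniform seed under a permutation of the coordinates.\<close>

lemma perfectly_smooth_mv_decoder:
  fixes g :: "'a::field"
  assumes m: "m > 0" and g: "g ^ m = 1"
    and P: "decoding_poly S g P"
    and u: "matching_vectors m h S n u"
  shows "perfectly_smooth (num_monomials P) n (zvecs m h)
           (mv_code m h g n u) (mv_decoder m h g P u)"
  unfolding perfectly_smooth_def
proof (intro conjI allI impI ballI)
  fix i r show "length (queries (mv_decoder m h g P u i) r) = num_monomials P"
    by (simp add: mv_decoder_def length_exponents)
next
  fix i x assume i: "i < n"
  have seed: "set_pmf (seed (mv_decoder m h g P u i)) = zvecs m h"
    using finite_zvecs zvecs_nonempty[OF m] by (simp add: mv_decoder_def)
  show "measure_pmf.prob (run_decoder (mv_decoder m h g P u i) (mv_code m h g n u x)) {x i} = 1"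
    by (subst measure_pmf.prob_eq_1)
       (auto simp: AE_measure_pmf_iff run_decoder_def seed mv_decoder_answer[OF m g P u i])
next
  fix i j assume "j < num_monomials P"
  then show "map_pmf (\<lambda>r. queries (mv_decoder m h g P u i) r ! j) (seed (mv_decoder m h g P u i)) =
      pmf_of_set (zvecs m h)"
    using bij_betw_zshift[OF m, of h "exponents P ! j" "u i"] finite_zvecs zvecs_nonempty[OF m]
    by (simp add: mv_decoder_def length_exponents map_pmf_of_set_bij_betw)
qed

theorem theorem5p1:
  fixes r l m1 m2 m t1 t2 t k1 k2 :: nat
    and p e q c :: "nat \<Rightarrow> nat"
    and \<gamma> \<gamma>1 \<gamma>2 :: "'f :: {field, finite}"
    and F1 F2 :: "'f set"
    and P1 P2 :: "'f poly"
  assumes "r > 1" and "inj_on p {..<r}"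
    and "\<forall>i<r. prime (p i) \<and> odd (p i) \<and> e i \<ge> 1"
    and "m1 = (\<Prod>i<r. p i ^ e i)"
    and "l > 1" and "inj_on q {..<l}"
    and "\<forall>i<l. prime (q i) \<and> odd (q i) \<and> c i \<ge> 1"
    and "m2 = (\<Prod>i<l. q i ^ c i)"
    and "gcd m1 m2 = 1" and "m = m1 * m2"
    and "t1 = ord m1 2" and "t2 = ord m2 2" and "t = ord m 2"
    and "CARD('f) = 2 ^ t"
    and "subfield F1 (ring_of_type_algebra :: 'f ring)" and "card F1 = 2 ^ t1"
    and "subfield F2 (ring_of_type_algebra :: 'f ring)" and "card F2 = 2 ^ t2"
    and "has_mult_order \<gamma> m"
    and "\<gamma>1 \<in> F1" and "has_mult_order \<gamma>1 m1"
    and "\<gamma>2 \<in> F2" and "has_mult_order \<gamma>2 m2"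
    and "\<forall>b. Polynomial.coeff P1 b \<in> F1"
    and "decoding_poly (canonical_set m1) \<gamma>1 P1" and "num_monomials P1 = k1"
    and "\<forall>b. Polynomial.coeff P2 b \<in> F2"
    and "decoding_poly (canonical_set m2) \<gamma>2 P2" and "num_monomials P2 = k2"
  shows "\<exists>(P :: 'f poly) k.
           decoding_poly (canonical_set m) \<gamma> P \<and> num_monomials P = k \<and> k \<le> k1 * k2 \<and>
           (\<forall>n h u. n \<ge> 1 \<longrightarrow> h \<ge> 1 \<longrightarrow> matching_vectors m h (canonical_set m) n u \<longrightarrow>
              (\<forall>\<delta>\<ge>0. locally_decodable k \<delta> (real k * \<delta>) n (zvecs m h)
                         (mv_code m h \<gamma> n u) (mv_decoder m h \<gamma> P u)) \<and>
              perfectly_smooth k n (zvecs m h)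
                (mv_code m h \<gamma> n u) (mv_decoder m h \<gamma> P u))"
proof -
  have m: "m > 0" and \<gamma>: "\<gamma> ^ m = 1"
    using \<open>has_mult_order \<gamma> m\<close> by (auto simp: has_mult_order_def)
  have o1: "\<gamma>1 ^ m1 = 1" and o2: "\<gamma>2 ^ m2 = 1"
    using \<open>has_mult_order \<gamma>1 m1\<close> \<open>has_mult_order \<gamma>2 m2\<close> by (auto simp: has_mult_order_def)
  \<comment> \<open>Both \<open>m1\<close> and \<open>m2\<close> divide \<open>m\<close>, so
    \<gamma> generates both smaller roots of unity.\<close>
  have "\<gamma>1 ^ m = 1" "\<gamma>2 ^ m = 1"
    using power_mult[of \<gamma>1 m1 m2] power_mult[of \<gamma>2 m2 m1] o1 o2 \<open>m = m1 * m2\<close>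
    by (simp_all add: mult.commute)
  then obtain a1 a2 where "\<gamma> ^ a1 = \<gamma>1" "\<gamma> ^ a2 = \<gamma>2"
    using root_of_unity_is_power[OF \<open>has_mult_order \<gamma> m\<close>] by metis
  moreover have "coprime m1 m2"
    using \<open>gcd m1 m2 = 1\<close> by (simp only: coprime_iff_gcd_eq_1)
  \<comment> \<open>\<open>P\<close> is fixed before \<open>n\<close>, \<open>h\<close> and
    \<open>u\<close>, so one polynomial serves all matching families.\<close>
  ultimately obtain P where P: "decoding_poly (canonical_set m) \<gamma> P"
    and k: "num_monomials P \<le> k1 * k2"
    using decoding_poly_mult_powers[OF _ o1 o2, of \<gamma> a1 a2 P1 P2]
      \<open>decoding_poly (canonical_set m1) \<gamma>1 P1\<close> \<open>decoding_poly (canonical_set m2) \<gamma>2 P2\<close>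
      \<open>m = m1 * m2\<close> \<open>num_monomials P1 = k1\<close> \<open>num_monomials P2 = k2\<close>
    by auto
  show ?thesis
  proof (intro exI conjI allI impI)
    show "decoding_poly (canonical_set m) \<gamma> P" by (fact P)
    show "num_monomials P = num_monomials P" ..
    show "num_monomials P \<le> k1 * k2" by (fact k)
    fix n h u assume u: "matching_vectors m h (canonical_set m) n u"
    \<comment> \<open>Smoothness is established first because local decodability is deduced from
      it.\<close>
    show smooth: "perfectly_smooth (num_monomials P) n (zvecs m h)
        (mv_code m h \<gamma> n u) (mv_decoder m h \<gamma> P u)"
      by (rule perfectly_smooth_mv_decoder[OF m \<gamma> P u])
    show "locally_decodable (num_monomials P) \<delta> (real (num_monomials P) * \<delta>) n (zvecs m h)
        (mv_code m h \<gamma> n u) (mv_decoder m h \<gamma> P u)" for \<delta>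
      by (rule perfectly_smooth_imp_locally_decodable[OF smooth finite_zvecs zvecs_nonempty[OF m]])
         (auto simp: words_def mv_code_def)
  qed
qed

end
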